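(* Let $d\ge1$, $\Delta x>0$, $c^1,\dots,c^d>0$, and let $a(t)=\{a_\alpha(t)\}_{\alpha\in\mathbb Z^d}$ be given by $$a_\alpha(t)=\sum_{i=0}^\infty\frac{t^i}{i!}\Bigl(\sum_{j=1}^dc^j\nabla_+^j\nabla_-^j\Bigr)^i\delta_\alpha .$$ Set $C_0=252$. Then for all $\alpha\in\mathbb Z^d$, $t>0$ and any $b^1,\dots,b^d\in[-\tfrac12,\tfrac12]$, $$|a_\alpha(t)|\le\pi^{d/2}\prod_{j=1}^d\frac1{\sqrt{4c^jt}}\exp\left(\frac{C_0c^jt}{2\Delta x^2}|b^j|^2-\alpha^jb^j\right).$$ In particular, for $t>0$ with $t\ge\max_{j\le d}|\alpha^j|\,\Delta x^2/\bigl(\min_{j\le d}2C_0c^j\bigr)$, $$|a_\alpha(t)|\le\pi^{d/2}\prod_{j=1}^d\frac1{\sqrt{4c^jt}}\exp\left(-\frac{(\alpha^j\Delta x)^2}{2C_0c^jt}\right).$$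
   Context: For sequences indexed by $\alpha\in\mathbb Z^d$: $\nabla_+^jf_\alpha=(f_{\alpha+e_j}-f_\alpha)/\Delta x$, $\nabla_-^jf_\alpha=(f_\alpha-f_{\alpha-e_j})/\Delta x$, with $e_j$ the canonical basis vectors. Discrete Dirac measure: $\delta_\alpha=\Delta x^{-d}$ if $\alpha=0$, $\delta_\alpha=0$ otherwise. Thus $a$ is the fundamental solution of the constant-coefficient semi-discrete heat equation: $\frac{d}{dt}a_\alpha=\sum_jc^j\nabla_+^j\nabla_-^ja_\alpha$, $a_\alpha(0)=\delta_\alpha$. *)

theory Defs
  imports "HOL-Analysis.Analysis"
begin

text \<open>The lattice \<open>\<int>\<^sup>d\<close> is \<open>int ^ 'd\<close>, so \<open>d = CARD('d) \<ge> 1\<close>,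
  and \<open>axis j 1\<close> is the canonical basis vector \<open>e\<^sub>j\<close>.\<close>

definition nabla_plus :: "real \<Rightarrow> 'd::finite \<Rightarrow> (int ^ 'd \<Rightarrow> real) \<Rightarrow> int ^ 'd \<Rightarrow> real" where
  "nabla_plus dx j f \<alpha> = (f (\<alpha> + axis j 1) - f \<alpha>) / dx"

definition nabla_minus :: "real \<Rightarrow> 'd::finite \<Rightarrow> (int ^ 'd \<Rightarrow> real) \<Rightarrow> int ^ 'd \<Rightarrow> real" where
  "nabla_minus dx j f \<alpha> = (f \<alpha> - f (\<alpha> - axis j 1)) / dx"

definition discrete_dirac :: "real \<Rightarrow> int ^ 'd::finite \<Rightarrow> real" where
  "discrete_dirac dx \<alpha> = (if \<alpha> = 0 then 1 / dx ^ CARD('d) else 0)"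

definition heat_operator ::
    "real \<Rightarrow> real ^ 'd::finite \<Rightarrow> (int ^ 'd \<Rightarrow> real) \<Rightarrow> int ^ 'd \<Rightarrow> real" where
  "heat_operator dx c f \<alpha> = (\<Sum>j\<in>UNIV. c $ j * nabla_plus dx j (nabla_minus dx j f) \<alpha>)"

text \<open>The exponential series of the operator applied to the Dirac measure, summed pointwise in
  \<open>\<alpha>\<close>; it converges absolutely, since \<open>heat_operator dx c\<close> is a bounded operator for the
  supremum norm.\<close>

definition heat_fundamental_solution ::
    "real \<Rightarrow> real ^ 'd::finite \<Rightarrow> real \<Rightarrow> int ^ 'd \<Rightarrow> real" where
  "heat_fundamental_solution dx c t \<alpha> =
     (\<Sum>i. t ^ i / fact i * (heat_operator dx c ^^ i) (discrete_dirac dx) \<alpha>)"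

definition C0 :: real where
  "C0 = 252"

end

theory Submission
  imports Defs "HOL-Probability.Probability"
begin

text \<open>
  Fourier analysis diagonalises the discrete heat operator. For complex frequencies \<open>z\<^sub>j\<close>, the wave
  \<open>\<alpha> \<mapsto> exp (- (\<Sum>j. \<alpha>\<^sub>j z\<^sub>j))\<close> is an eigenfunction with eigenvalue
  \<open>\<Sum>j. c\<^sub>j / dx\<^sup>2 * (exp z\<^sub>j + exp (- z\<^sub>j) - 2)\<close>. With \<open>z\<^sub>j = b\<^sub>j + \<i> \<theta>\<^sub>j\<close> and a fixed real shift \<open>b\<close>, averaging
  the waves over all phases \<open>\<theta>\<close> in the torus produces the Dirac measure up to the factor
  \<open>dx ^ d\<close>, whatever \<open>b\<close> is. So powers of the operator, and then the exponential series, become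
  averages of powers and of the exponential of the eigenvalue
  (\<open>heat_operator_power_dirac\<close>, \<open>heat_fundamental_solution_eq_integral\<close>). Putting the shift into the
  waves from the start yields the exponential weight \<open>exp (- \<alpha>\<^sub>j b\<^sub>j)\<close> without moving any contour.

  The modulus of the integrand factorises over the coordinates, so everything reduces to one circle and
  \<open>s = c\<^sub>j t / dx\<^sup>2\<close>. There
  \<open>cosh b cos \<theta> - 1 \<le> (cosh b - 1) - (1 - cos \<theta>)\<close>; the first part costs a factor \<open>exp (126 s b\<^sup>2)\<close>, and
  \<open>1 - cos \<theta> \<ge> 2 \<theta>\<^sup>2 / \<pi>\<^sup>2\<close> turns the second into a Gaussian, whose integral gives the decay
  \<open>t powr (- 1/2)\<close> per coordinate (\<open>integral_exp_cosh_cos_le\<close>).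

  The Gaussian estimate comes from the minimiser \<open>b\<^sub>j = \<alpha>\<^sub>j dx\<^sup>2 / (C0 c\<^sub>j t)\<close> of the exponent. The
  assumed lower bound on \<open>t\<close> only gives \<open>\<bar>b\<^sub>j\<bar> \<le> 2\<close>, not \<open>\<bar>b\<^sub>j\<bar> \<le> 1/2\<close>. For this reason the exponential
  bound is established for all \<open>\<bar>b\<^sub>j\<bar> \<le> 2\<close>, where \<open>cosh b - 1 \<le> 63 b\<^sup>2\<close> still holds with room to spare.
\<close>

section \<open>Scalar estimates\<close>

text \<open>Jordan's inequality: sine is concave on \<open>[0, \<pi>]\<close>, hence above its chord from \<open>0\<close> to \<open>\<pi>/2\<close>.\<close>

lemma sin_ge_chord:
  fixes x :: real
  assumes "0 \<le> x" "x \<le> pi / 2"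
  shows "2 * x / pi \<le> sin x"
proof -
  have "concave_on {0..pi} (sin :: real \<Rightarrow> real)"
  proof (rule f''_le0_imp_concave)
    show "(sin has_real_derivative cos x) (at x)" for x :: real
      by (auto intro!: derivative_eq_intros)
    show "(cos has_real_derivative - sin x) (at x)" for x :: real
      by (auto intro!: derivative_eq_intros)
    show "- sin x \<le> 0" if "x \<in> {0..pi}" for x :: real
      using that by (simp add: sin_ge_zero)
  qed auto
  moreover have "2 * x / pi \<le> 1" "0 \<le> 2 * x / pi"
    using assms by (auto simp: field_simps)
  ultimately have "sin ((1 - 2 * x / pi) *\<^sub>R 0 + (2 * x / pi) *\<^sub>R (pi / 2))
      \<ge> (1 - 2 * x / pi) * sin 0 + (2 * x / pi) * sin (pi / 2)"
    by (intro concave_onD) auto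
  then show ?thesis by simp
qed

lemma one_minus_cos_ge:
  fixes \<theta> :: real
  assumes "\<bar>\<theta>\<bar> \<le> pi"
  shows "2 * \<theta>\<^sup>2 / pi\<^sup>2 \<le> 1 - cos \<theta>"
proof -
  have "2 * (\<bar>\<theta>\<bar> / 2) / pi \<le> sin (\<bar>\<theta>\<bar> / 2)"
    using assms by (intro sin_ge_chord) auto
  then have "(\<bar>\<theta>\<bar> / pi)\<^sup>2 \<le> (sin (\<bar>\<theta>\<bar> / 2))\<^sup>2"
    by (intro power_mono) auto
  moreover have "cos \<theta> = 1 - 2 * (sin (\<bar>\<theta>\<bar> / 2))\<^sup>2"
    using cos_double_sin[of "\<bar>\<theta>\<bar> / 2"] by simp
  ultimately show ?thesis by (simp add: power_divide)
qed

text \<open>Since \<open>cosh b - 1 = 2 sinh\<^sup>2 (b/2)\<close> and \<open>\<bar>b/2\<bar> \<le> 1\<close>, it is enough to bound \<open>sinh\<close> linearly on \<open>[0, 1]\<close>.\<close>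

lemma cosh_minus_one_le:
  fixes b :: real
  assumes "\<bar>b\<bar> \<le> 2"
  shows "cosh b - 1 \<le> 9 / 8 * b\<^sup>2"
proof -
  define y where "y = \<bar>b\<bar> / 2"
  have y: "0 \<le> y" "y \<le> 1" using assms by (auto simp: y_def)
  have "exp y \<le> 1 + y + y\<^sup>2" using y by (intro exp_bound)
  moreover have "exp (- y) \<ge> 1 - y" using exp_ge_add_one_self[of "- y"] by simp
  moreover have "y\<^sup>2 \<le> y" using y by (simp add: power2_eq_square mult_left_le)
  ultimately have "sinh y \<le> 3 / 2 * y" by (simp add: sinh_field_def)
  moreover have "0 \<le> sinh y" using y by simp
  ultimately have "(sinh y)\<^sup>2 \<le> (3 / 2 * y)\<^sup>2" by (intro power_mono)
  moreover have "cosh b = 1 + 2 * (sinh y)\<^sup>2"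
  proof -
    have "cosh b = cosh (2 * y)" by (simp add: y_def abs_if)
    then show ?thesis by (simp add: cosh_double cosh_square_eq)
  qed
  ultimately show ?thesis by (simp add: y_def power_mult_distrib power_divide)
qed

lemma has_integral_gaussian:
  fixes a :: real
  assumes "a > 0"
  shows "has_bochner_integral lborel (\<lambda>x. exp (- (a * x\<^sup>2))) (sqrt (pi / a))"
proof -
  define \<sigma> where "\<sigma> = 1 / sqrt (2 * a)"
  have \<sigma>: "\<sigma> > 0" "\<sigma>\<^sup>2 = 1 / (2 * a)" using assms by (auto simp: \<sigma>_def power_divide)
  have "has_bochner_integral lborel (\<lambda>x. sqrt (pi / a) * normal_density 0 \<sigma> x) (sqrt (pi / a) * 1)"
    using \<sigma> by (intro has_bochner_integral_mult_right)
      (auto simp: has_bochner_integral_iff integral_normal_density)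
  also have "(\<lambda>x. sqrt (pi / a) * normal_density 0 \<sigma> x) = (\<lambda>x. exp (- (a * x\<^sup>2)))"
    using assms by (simp add: normal_density_def \<sigma> fun_eq_iff real_sqrt_divide)
  finally show ?thesis by simp
qed

section \<open>The circle and the torus\<close>

definition circle_measure :: "real measure" where
  "circle_measure = density lborel (\<lambda>\<theta>. ennreal (indicator {-pi..pi} \<theta> / (2 * pi)))"

lemma sets_circle_measure [measurable_cong, simp]: "sets circle_measure = sets borel"
  and space_circle_measure [simp]: "space circle_measure = UNIV"
  by (simp_all add: circle_measure_def)

lemma integral_circle_measure:
  fixes f :: "real \<Rightarrow> 'b::{banach, second_countable_topology}"
  assumes [measurable]: "f \<in> borel_measurable borel"
  shows "(\<integral>\<theta>. f \<theta> \<partial>circle_measure) = (\<integral>\<theta>. indicator {-pi..pi} \<theta> *\<^sub>R f \<theta> \<partial>lborel) /\<^sub>R (2 * pi)"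
proof -
  have "(\<integral>\<theta>. f \<theta> \<partial>circle_measure) = (\<integral>\<theta>. (indicator {-pi..pi} \<theta> / (2 * pi)) *\<^sub>R f \<theta> \<partial>lborel)"
    unfolding circle_measure_def by (intro integral_density) auto
  also have "\<dots> = (\<integral>\<theta>. inverse (2 * pi) *\<^sub>R (indicator {-pi..pi} \<theta> *\<^sub>R f \<theta>) \<partial>lborel)"
    by (simp add: field_simps)
  finally show ?thesis by (simp only: integral_scaleR_right)
qed

interpretation circle: prob_space circle_measure
proof
  have "emeasure circle_measure (space circle_measure)
      = (\<integral>\<^sup>+\<theta>. ennreal (1 / (2 * pi)) * indicator {-pi..pi} \<theta> \<partial>lborel)"
    by (auto simp: circle_measure_def emeasure_density intro!: nn_integral_cong split: split_indicator)
  also have "\<dots> = ennreal (1 / (2 * pi)) * ennreal (2 * pi)"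
    by (subst nn_integral_cmult_indicator) auto
  also have "\<dots> = 1" by (subst ennreal_mult[symmetric]) auto
  finally show "emeasure circle_measure (space circle_measure) = 1" .
qed

lemma AE_circle_measure: "AE \<theta> in circle_measure. \<bar>\<theta>\<bar> \<le> pi"
  unfolding circle_measure_def
  by (subst AE_density) (auto split: split_indicator)

text \<open>For \<open>n \<noteq> 0\<close> the integrand has a \<open>2\<pi>\<close>-periodic primitive, for every real shift \<open>b\<close>.\<close>

lemma integral_character_circle:
  fixes n :: int and b :: real
  shows "(\<integral>\<theta>. exp (- (of_int n * (complex_of_real b + \<i> * of_real \<theta>))) \<partial>circle_measure)
    = (if n = 0 then 1 else 0)"
proof (cases "n = 0")
  case True
  then show ?thesis using circle.prob_space by simp
next
  case False
  define f where "f = (\<lambda>\<theta>. exp (- (of_int n * (complex_of_real b + \<i> * of_real \<theta>))))"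
  \<comment> \<open>the primitive, as \<open>1 / (- n \<i>) = \<i> / n\<close>\<close>
  define F where "F = (\<lambda>\<theta>. f \<theta> * (\<i> / of_int n))"
  have "(\<integral>\<theta>. indicator {-pi..pi} \<theta> *\<^sub>R f \<theta> \<partial>lborel) = F pi - F (- pi)"
  proof (rule integral_FTC_Icc)
    fix \<theta> :: real
    have "((\<lambda>z. exp (- (of_int n * (complex_of_real b + \<i> * z))) * (\<i> / of_int n))
        has_field_derivative f \<theta>) (at (of_real \<theta>))"
      using False by (auto intro!: derivative_eq_intros simp: f_def)
    from has_vector_derivative_real_field[OF this]
    show "(F has_vector_derivative f \<theta>) (at \<theta> within {-pi..pi})"
      by (simp add: F_def f_def)
  next
    show "continuous_on {-pi..pi} f"
      unfolding f_def by (intro continuous_intros)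
  qed simp
  also have "f pi = f (- pi)"
  proof -
    have "f (- pi) = exp (- (of_int n * (complex_of_real b + \<i> * of_real pi)) + of_int n * (2 * of_real pi * \<i>))"
      by (simp add: f_def algebra_simps)
    also have "\<dots> = f pi"
      unfolding exp_add f_def using exp_integer_2pi[of "of_int n"] by (simp add: mult_ac)
    finally show ?thesis ..
  qed
  then have "F pi - F (- pi) = 0" by (simp add: F_def)
  finally have "(\<integral>\<theta>. f \<theta> \<partial>circle_measure) = 0"
    by (subst integral_circle_measure) (auto simp: f_def)
  then show ?thesis using False by (simp add: f_def)
qed

text \<open>The one-dimensional estimate: the exponent is dominated by a constant minus a multiple of \<open>\<theta>\<^sup>2\<close>, and
  the Gaussian is then integrated over the whole line. The constant \<open>126\<close> is \<open>C0 / 2\<close>.\<close>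

lemma integral_exp_cosh_cos_le:
  fixes s b :: real
  assumes s: "s > 0" and b: "\<bar>b\<bar> \<le> 2"
  shows "(\<integral>\<theta>. exp (s * (2 * cosh b * cos \<theta> - 2)) \<partial>circle_measure)
    \<le> sqrt (pi / (4 * s)) * exp (126 * s * b\<^sup>2)"
proof -
  \<comment> \<open>from \<open>2 s (1 - cos \<theta>) \<ge> 2 s * 2 \<theta>\<^sup>2 / \<pi>\<^sup>2\<close>\<close>
  define a where "a = 4 * s / pi\<^sup>2"
  have a: "a > 0" using s by (simp add: a_def)
  define g where "g = (\<lambda>\<theta>. exp (- (a * \<theta>\<^sup>2)))"
  have [measurable]: "g \<in> borel_measurable borel" unfolding g_def by measurable
  have G: "has_bochner_integral lborel g (sqrt (pi / a))"
    unfolding g_def using a by (rule has_integral_gaussian)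
  have pointwise: "exp (s * (2 * cosh b * cos \<theta> - 2)) \<le> exp (126 * s * b\<^sup>2) * g \<theta>"
    if "\<bar>\<theta>\<bar> \<le> pi" for \<theta>
  proof -
    have "cosh b * cos \<theta> - 1 \<le> (cosh b - 1) + (cos \<theta> - 1)"
      using mult_left_mono[of "cos \<theta>" 1 "cosh b - 1"] cosh_real_ge_1[of b]
      by (simp add: algebra_simps)
    also have "\<dots> \<le> 63 * b\<^sup>2 - 2 * \<theta>\<^sup>2 / pi\<^sup>2"
      using cosh_minus_one_le[OF b] one_minus_cos_ge[OF that] zero_le_power2[of b] by linarith
    finally have "2 * s * (cosh b * cos \<theta> - 1) \<le> 2 * s * (63 * b\<^sup>2 - 2 * \<theta>\<^sup>2 / pi\<^sup>2)"
      using s by (intro mult_left_mono) auto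
    then show ?thesis
      by (simp add: g_def a_def algebra_simps flip: exp_add)
  qed
  have g_int: "integrable circle_measure (\<lambda>\<theta>. exp (126 * s * b\<^sup>2) * g \<theta>)"
    by (intro circle.integrable_const_bound[where B = "exp (126 * s * b\<^sup>2)"])
       (use a in \<open>auto simp: g_def\<close>)
  have "(\<integral>\<theta>. exp (s * (2 * cosh b * cos \<theta> - 2)) \<partial>circle_measure)
      \<le> (\<integral>\<theta>. exp (126 * s * b\<^sup>2) * g \<theta> \<partial>circle_measure)"
  proof (rule integral_mono_AE')
    show "AE \<theta> in circle_measure. exp (s * (2 * cosh b * cos \<theta> - 2)) \<le> exp (126 * s * b\<^sup>2) * g \<theta>"
      using AE_circle_measure by eventually_elim (rule pointwise)
  qed (use g_int in \<open>auto simp: g_def\<close>)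
  also have "\<dots> = exp (126 * s * b\<^sup>2) * (\<integral>\<theta>. g \<theta> \<partial>circle_measure)"
    by simp
  also have "(\<integral>\<theta>. g \<theta> \<partial>circle_measure) \<le> sqrt (pi / (4 * s))"
  proof -
    have "(\<integral>\<theta>. indicator {-pi..pi} \<theta> *\<^sub>R g \<theta> \<partial>lborel) \<le> (\<integral>\<theta>. g \<theta> \<partial>lborel)"
      using G by (intro integral_mono') (auto simp: has_bochner_integral_iff g_def split: split_indicator)
    also have "\<dots> = sqrt (pi / a)" using G by (simp add: has_bochner_integral_iff)
    also have "pi / a = (pi / (4 * s)) * pi\<^sup>2" by (simp add: a_def)
    also have "sqrt \<dots> = sqrt (pi / (4 * s)) * pi" by (simp only: real_sqrt_mult) simp
    finally have "(\<integral>\<theta>. g \<theta> \<partial>circle_measure) \<le> sqrt (pi / (4 * s)) * pi / (2 * pi)"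
      by (subst integral_circle_measure) (auto simp: divide_simps mult_ac)
    also have "\<dots> \<le> sqrt (pi / (4 * s))" using s by simp
    finally show ?thesis .
  qed
  finally show ?thesis by (simp add: mult_ac)
qed

definition torus_measure :: "('d::finite \<Rightarrow> real) measure" where
  "torus_measure = PiM UNIV (\<lambda>_. circle_measure)"

lemma sets_torus_measure [measurable_cong]:
  "sets (torus_measure :: ('d::finite \<Rightarrow> real) measure) = sets (PiM UNIV (\<lambda>_. borel))"
  unfolding torus_measure_def by (intro sets_PiM_cong) auto

interpretation torus: prob_space "torus_measure :: ('d::finite \<Rightarrow> real) measure"
  unfolding torus_measure_def by (intro prob_space_PiM circle.prob_space_axioms)

lemma integral_torus_prod:
  fixes f :: "'d::finite \<Rightarrow> real \<Rightarrow> 'b::{real_normed_field, banach, second_countable_topology}"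
  assumes "\<And>j. integrable circle_measure (f j)"
  shows "(\<integral>\<theta>. (\<Prod>j\<in>UNIV. f j (\<theta> j)) \<partial>torus_measure) = (\<Prod>j\<in>UNIV. \<integral>x. f j x \<partial>circle_measure)"
proof -
  interpret product_sigma_finite "\<lambda>_::'d. circle_measure"
    by unfold_locales
  show ?thesis
    unfolding torus_measure_def by (intro product_integral_prod assms) auto
qed

section \<open>Waves with complex frequency\<close>

definition frequency :: "real ^ 'd::finite \<Rightarrow> ('d \<Rightarrow> real) \<Rightarrow> 'd \<Rightarrow> complex" where
  "frequency b \<theta> j = of_real (b $ j) + \<i> * of_real (\<theta> j)"

definition wave :: "real ^ 'd::finite \<Rightarrow> int ^ 'd \<Rightarrow> ('d \<Rightarrow> real) \<Rightarrow> complex" where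
  "wave b \<alpha> \<theta> = (\<Prod>j\<in>UNIV. exp (- (of_int (\<alpha> $ j) * frequency b \<theta> j)))"

text \<open>The eigenvalue of the heat operator on the wave with the same frequency.\<close>

definition heat_symbol :: "real \<Rightarrow> real ^ 'd::finite \<Rightarrow> real ^ 'd \<Rightarrow> ('d \<Rightarrow> real) \<Rightarrow> complex" where
  "heat_symbol dx c b \<theta> = (\<Sum>j\<in>UNIV. of_real (c $ j / dx\<^sup>2) *
     (exp (frequency b \<theta> j) + exp (- frequency b \<theta> j) - 2))"

lemma wave_shift:
  "wave b (\<alpha> + axis j 1) \<theta> = exp (- frequency b \<theta> j) * wave b \<alpha> \<theta>"
  "wave b (\<alpha> - axis j 1) \<theta> = exp (frequency b \<theta> j) * wave b \<alpha> \<theta>"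
proof -
  have "wave b (\<alpha> + axis j 1) \<theta> = (\<Prod>k\<in>UNIV. (if k = j then exp (- frequency b \<theta> j) else 1) *
      exp (- (of_int (\<alpha> $ k) * frequency b \<theta> k)))"
    unfolding wave_def by (intro prod.cong) (auto simp: axis_def algebra_simps exp_diff exp_minus field_simps)
  then show "wave b (\<alpha> + axis j 1) \<theta> = exp (- frequency b \<theta> j) * wave b \<alpha> \<theta>"
    by (simp add: prod.distrib wave_def)
  have "wave b (\<alpha> - axis j 1) \<theta> = (\<Prod>k\<in>UNIV. (if k = j then exp (frequency b \<theta> j) else 1) *
      exp (- (of_int (\<alpha> $ k) * frequency b \<theta> k)))"
    unfolding wave_def by (intro prod.cong) (auto simp: axis_def algebra_simps exp_diff exp_minus field_simps)
  then show "wave b (\<alpha> - axis j 1) \<theta> = exp (frequency b \<theta> j) * wave b \<alpha> \<theta>"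
    by (simp add: prod.distrib wave_def)
qed

lemma norm_wave: "norm (wave b \<alpha> \<theta>) = (\<Prod>j\<in>UNIV. exp (- (of_int (\<alpha> $ j) * b $ j)))"
  by (simp add: wave_def frequency_def prod_norm[symmetric])

lemma norm_heat_symbol_le:
  "norm (heat_symbol dx c b \<theta>) \<le> (\<Sum>j\<in>UNIV. \<bar>c $ j\<bar> / dx\<^sup>2 * (exp (b $ j) + exp (- b $ j) + 2))"
  unfolding heat_symbol_def
proof (intro sum_norm_le)
  fix j
  have "norm (exp (frequency b \<theta> j) + exp (- frequency b \<theta> j) - 2)
      \<le> norm (exp (frequency b \<theta> j)) + norm (exp (- frequency b \<theta> j)) + norm (2 :: complex)"
    by (metis norm_triangle_ineq norm_triangle_ineq4 add_right_mono order_trans)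
  also have "\<dots> = exp (b $ j) + exp (- b $ j) + 2" by (simp add: frequency_def)
  finally show "norm (of_real (c $ j / dx\<^sup>2) * (exp (frequency b \<theta> j) + exp (- frequency b \<theta> j) - 2))
      \<le> \<bar>c $ j\<bar> / dx\<^sup>2 * (exp (b $ j) + exp (- b $ j) + 2)"
    unfolding norm_mult by (intro mult_mono) (auto simp: norm_divide norm_power)
qed

lemma Re_heat_symbol:
  "Re (heat_symbol dx c b \<theta>) = (\<Sum>j\<in>UNIV. c $ j / dx\<^sup>2 * (2 * cosh (b $ j) * cos (\<theta> j) - 2))"
  unfolding heat_symbol_def Re_sum
proof (intro sum.cong refl)
  fix j
  have "Re (exp (frequency b \<theta> j) + exp (- frequency b \<theta> j) - 2) = 2 * cosh (b $ j) * cos (\<theta> j) - 2"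
    by (simp add: frequency_def Re_exp cosh_field_def field_simps)
  then show "Re (of_real (c $ j / dx\<^sup>2) * (exp (frequency b \<theta> j) + exp (- frequency b \<theta> j) - 2))
      = c $ j / dx\<^sup>2 * (2 * cosh (b $ j) * cos (\<theta> j) - 2)"
    by (simp only: Re_complex_of_real Im_complex_of_real times_complex.sel)
qed

lemma measurable_wave [measurable]: "wave b \<alpha> \<in> borel_measurable torus_measure"
  unfolding wave_def[abs_def] frequency_def by measurable

lemma measurable_heat_symbol [measurable]: "heat_symbol dx c b \<in> borel_measurable torus_measure"
  unfolding heat_symbol_def[abs_def] frequency_def by measurable

text \<open>Orthogonality of characters in each coordinate; this is where the Dirac measure enters.\<close>

lemma integral_wave: "(\<integral>\<theta>. wave b \<alpha> \<theta> \<partial>torus_measure) = (if \<alpha> = 0 then 1 else 0)"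
proof -
  have "(\<integral>\<theta>. wave b \<alpha> \<theta> \<partial>torus_measure)
      = (\<Prod>j\<in>UNIV. \<integral>x. exp (- (of_int (\<alpha> $ j) * (of_real (b $ j) + \<i> * complex_of_real x))) \<partial>circle_measure)"
    unfolding wave_def frequency_def
    by (intro integral_torus_prod
        circle.integrable_const_bound[where B = "exp (- (of_int (\<alpha> $ j) * b $ j))" for j]) auto
  also have "\<dots> = (if \<alpha> = 0 then 1 else 0)"
    by (auto simp: integral_character_circle vec_eq_iff)
  finally show ?thesis .
qed

lemma integrable_symbol_wave:
  "integrable torus_measure (\<lambda>\<theta>. heat_symbol dx c b \<theta> ^ i * wave b \<alpha> \<theta>)"
proof (rule torus.integrable_const_bound)
  show "AE \<theta> in torus_measure. norm (heat_symbol dx c b \<theta> ^ i * wave b \<alpha> \<theta>)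
      \<le> (\<Sum>j\<in>UNIV. \<bar>c $ j\<bar> / dx\<^sup>2 * (exp (b $ j) + exp (- b $ j) + 2)) ^ i
        * (\<Prod>j\<in>UNIV. exp (- (of_int (\<alpha> $ j) * b $ j)))"
    unfolding norm_mult norm_power norm_wave
    by (intro AE_I2 mult_right_mono power_mono norm_heat_symbol_le) (auto intro: prod_nonneg)
qed measurable

text \<open>Induction on the power: applying the operator to the waves under the integral multiplies the integrand
  by the symbol.\<close>

lemma heat_operator_power_dirac:
  fixes dx :: real and c b :: "real ^ 'd::finite"
  shows "complex_of_real ((heat_operator dx c ^^ i) (discrete_dirac dx) \<alpha>)
    = (\<integral>\<theta>. heat_symbol dx c b \<theta> ^ i * wave b \<alpha> \<theta> \<partial>torus_measure) / of_real (dx ^ CARD('d))"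
proof (induction i arbitrary: \<alpha>)
  case 0
  then show ?case by (simp add: discrete_dirac_def integral_wave)
next
  case (Suc i)
  define u where "u = (heat_operator dx c ^^ i) (discrete_dirac dx)"
  define I where "I = (\<lambda>f :: ('d \<Rightarrow> real) \<Rightarrow> complex. (\<integral>\<theta>. f \<theta> \<partial>torus_measure) / complex_of_real (dx ^ CARD('d)))"
  define W where "W = (\<lambda>\<alpha> \<theta>. heat_symbol dx c b \<theta> ^ i * wave b \<alpha> \<theta>)"
  have W [simp]: "integrable torus_measure (W \<alpha>)" for \<alpha>
    unfolding W_def by (rule integrable_symbol_wave)
  have "heat_operator dx c u \<alpha>
      = (\<Sum>j\<in>UNIV. c $ j / dx\<^sup>2 * (u (\<alpha> + axis j 1) + u (\<alpha> - axis j 1) - 2 * u \<alpha>))"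
    unfolding heat_operator_def nabla_plus_def nabla_minus_def
    by (intro sum.cong) (auto simp: power2_eq_square diff_divide_distrib add_divide_distrib algebra_simps)
  then have "complex_of_real (heat_operator dx c u \<alpha>) = (\<Sum>j\<in>UNIV. of_real (c $ j / dx\<^sup>2) *
      (I (W (\<alpha> + axis j 1)) + I (W (\<alpha> - axis j 1)) - 2 * I (W \<alpha>)))"
    using Suc.IH by (simp add: u_def I_def W_def)
  also have "\<dots> = (\<Sum>j\<in>UNIV. of_real (c $ j / dx\<^sup>2) * ((\<integral>\<theta>. W (\<alpha> + axis j 1) \<theta> \<partial>torus_measure)
      + (\<integral>\<theta>. W (\<alpha> - axis j 1) \<theta> \<partial>torus_measure) - 2 * (\<integral>\<theta>. W \<alpha> \<theta> \<partial>torus_measure)))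
      / complex_of_real (dx ^ CARD('d))"
    by (simp only: I_def sum_divide_distrib times_divide_eq_right
        add_divide_distrib[symmetric] diff_divide_distrib[symmetric])
  also have "\<dots> = I (\<lambda>\<theta>. \<Sum>j\<in>UNIV. of_real (c $ j / dx\<^sup>2) *
      (W (\<alpha> + axis j 1) \<theta> + W (\<alpha> - axis j 1) \<theta> - 2 * W \<alpha> \<theta>))"
    unfolding I_def by simp
  also have "(\<lambda>\<theta>. \<Sum>j\<in>UNIV. of_real (c $ j / dx\<^sup>2) *
      (W (\<alpha> + axis j 1) \<theta> + W (\<alpha> - axis j 1) \<theta> - 2 * W \<alpha> \<theta>))
      = (\<lambda>\<theta>. heat_symbol dx c b \<theta> ^ Suc i * wave b \<alpha> \<theta>)"
  proof
    fix \<theta> :: "'d \<Rightarrow> real"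
    have "heat_symbol dx c b \<theta> ^ Suc i * wave b \<alpha> \<theta> = heat_symbol dx c b \<theta> * W \<alpha> \<theta>"
      by (simp add: W_def)
    also have "\<dots> = (\<Sum>j\<in>UNIV. of_real (c $ j / dx\<^sup>2) *
      (W (\<alpha> + axis j 1) \<theta> + W (\<alpha> - axis j 1) \<theta> - 2 * W \<alpha> \<theta>))"
      unfolding heat_symbol_def sum_distrib_right
      by (intro sum.cong refl) (simp add: W_def wave_shift heat_symbol_def algebra_simps)
    finally show "(\<Sum>j\<in>UNIV. of_real (c $ j / dx\<^sup>2) *
      (W (\<alpha> + axis j 1) \<theta> + W (\<alpha> - axis j 1) \<theta> - 2 * W \<alpha> \<theta>))
      = heat_symbol dx c b \<theta> ^ Suc i * wave b \<alpha> \<theta>" ..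
  qed
  finally show ?case by (simp add: u_def I_def)
qed

text \<open>The symbol is bounded on the torus for fixed \<open>b\<close>, so the terms of the series are dominated by those of
  an exponential series and summation commutes with integration.\<close>

lemma heat_fundamental_solution_eq_integral:
  fixes dx t :: real and c b :: "real ^ 'd::finite"
  shows "complex_of_real (heat_fundamental_solution dx c t \<alpha>)
    = (\<integral>\<theta>. exp (of_real t * heat_symbol dx c b \<theta>) * wave b \<alpha> \<theta> \<partial>torus_measure) / of_real (dx ^ CARD('d))"
proof -
  define A where "A = (\<Sum>j\<in>UNIV. \<bar>c $ j\<bar> / dx\<^sup>2 * (exp (b $ j) + exp (- b $ j) + 2))"
  define B where "B = (\<Prod>j\<in>UNIV. exp (- (of_int (\<alpha> $ j) * b $ j)))"
  define f where "f = (\<lambda>i \<theta>. of_real (t ^ i / fact i) * (heat_symbol dx c b \<theta> ^ i * wave b \<alpha> \<theta>))"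
  have f_int: "integrable torus_measure (f i)" for i
    unfolding f_def by (intro integrable_mult_right integrable_symbol_wave)
  have f_bound: "norm (f i \<theta>) \<le> (\<bar>t\<bar> * A) ^ i / fact i * B" for i \<theta>
  proof -
    have "norm (f i \<theta>) = \<bar>t\<bar> ^ i / fact i * (norm (heat_symbol dx c b \<theta>) ^ i * B)"
      by (simp add: f_def norm_mult norm_power norm_divide norm_wave B_def power_abs abs_mult)
    also have "\<dots> \<le> \<bar>t\<bar> ^ i / fact i * (A ^ i * B)"
      unfolding A_def B_def
      by (intro mult_left_mono mult_right_mono power_mono norm_heat_symbol_le) (auto intro: prod_nonneg)
    finally show ?thesis by (simp add: power_mult_distrib)
  qed
  have bound_summable: "summable (\<lambda>i. (\<bar>t\<bar> * A) ^ i / fact i * B)"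
    using summable_exp[of "\<bar>t\<bar> * A"] by (intro summable_mult2) (simp add: field_simps)
  have "(\<lambda>i. \<integral>\<theta>. f i \<theta> \<partial>torus_measure) sums (\<integral>\<theta>. (\<Sum>i. f i \<theta>) \<partial>torus_measure)"
  proof (rule sums_integral[OF f_int])
    show "AE \<theta> in torus_measure. summable (\<lambda>i. norm (f i \<theta>))"
      by (intro AE_I2 summable_comparison_test'[OF bound_summable, of 0]) (simp only: real_norm_def abs_norm_cancel f_bound)
    have norm_bound: "norm (\<integral>\<theta>. norm (f i \<theta>) \<partial>torus_measure) \<le> (\<bar>t\<bar> * A) ^ i / fact i * B" for i
    proof -
      have "(\<integral>\<theta>. norm (f i \<theta>) \<partial>torus_measure)
          \<le> (\<integral>\<theta>. (\<bar>t\<bar> * A) ^ i / fact i * B \<partial>(torus_measure :: ('d \<Rightarrow> real) measure))"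
        using f_int f_bound by (intro integral_mono) auto
      also have "\<dots> = (\<bar>t\<bar> * A) ^ i / fact i * B"
        unfolding lebesgue_integral_const torus.prob_space by (rule scaleR_one)
      finally show ?thesis by (simp add: integral_nonneg_AE)
    qed
    show "summable (\<lambda>i. \<integral>\<theta>. norm (f i \<theta>) \<partial>torus_measure)"
      by (rule summable_comparison_test'[OF bound_summable, of 0]) (rule norm_bound)
  qed
  also have "(\<lambda>\<theta>. \<Sum>i. f i \<theta>) = (\<lambda>\<theta>. exp (of_real t * heat_symbol dx c b \<theta>) * wave b \<alpha> \<theta>)"
  proof
    fix \<theta> :: "'d \<Rightarrow> real"
    have "(\<lambda>i. (of_real t * heat_symbol dx c b \<theta>) ^ i /\<^sub>R fact i * wave b \<alpha> \<theta>)
        sums (exp (of_real t * heat_symbol dx c b \<theta>) * wave b \<alpha> \<theta>)"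
      by (intro sums_mult2 exp_converges)
    then show "(\<Sum>i. f i \<theta>) = exp (of_real t * heat_symbol dx c b \<theta>) * wave b \<alpha> \<theta>"
      by (intro sums_unique[symmetric])
        (simp add: f_def power_mult_distrib scaleR_conv_of_real field_simps)
  qed
  finally have "(\<lambda>i. (\<integral>\<theta>. f i \<theta> \<partial>torus_measure) / of_real (dx ^ CARD('d))) sums
      ((\<integral>\<theta>. exp (of_real t * heat_symbol dx c b \<theta>) * wave b \<alpha> \<theta> \<partial>torus_measure) / of_real (dx ^ CARD('d)))"
    by (rule sums_divide)
  also have "(\<lambda>i. (\<integral>\<theta>. f i \<theta> \<partial>torus_measure) / of_real (dx ^ CARD('d)))
      = (\<lambda>i. complex_of_real (t ^ i / fact i * (heat_operator dx c ^^ i) (discrete_dirac dx) \<alpha>))"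
    unfolding of_real_mult heat_operator_power_dirac[where b = b] f_def by simp
  finally have series: "(\<lambda>i. complex_of_real (t ^ i / fact i * (heat_operator dx c ^^ i) (discrete_dirac dx) \<alpha>)) sums
      ((\<integral>\<theta>. exp (of_real t * heat_symbol dx c b \<theta>) * wave b \<alpha> \<theta> \<partial>torus_measure) / of_real (dx ^ CARD('d)))" .
  then have "summable (\<lambda>i. t ^ i / fact i * (heat_operator dx c ^^ i) (discrete_dirac dx) \<alpha>)"
    unfolding summable_of_real_iff[symmetric, where 'a = complex] by (rule sums_summable)
  from suminf_of_real[OF this, where ?'a = complex] show ?thesis
    unfolding heat_fundamental_solution_def sums_unique[OF series] .
qed

section \<open>The heat kernel bound\<close>

text \<open>The representation holds for every shift, so \<open>b\<close> is a free parameter of the bound. Taking moduli under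
  the integral leaves a product of one-dimensional integrals.\<close>

lemma heat_fundamental_solution_bound:
  fixes dx t :: real and c b :: "real ^ 'd::finite"
  assumes dx: "dx > 0" and c: "\<And>j. c $ j > 0" and t: "t > 0" and b: "\<And>j. \<bar>b $ j\<bar> \<le> 2"
  shows "\<bar>heat_fundamental_solution dx c t \<alpha>\<bar> \<le> pi powr (real CARD('d) / 2) *
    (\<Prod>j\<in>UNIV. 1 / sqrt (4 * c $ j * t) *
      exp (C0 * c $ j * t / (2 * dx\<^sup>2) * \<bar>b $ j\<bar>\<^sup>2 - real_of_int (\<alpha> $ j) * b $ j))"
proof -
  define s where "s = (\<lambda>j. c $ j * t / dx\<^sup>2)"
  have s: "s j > 0" for j using dx c t by (simp add: s_def)
  define w where "w = (\<lambda>j. exp (- (real_of_int (\<alpha> $ j) * b $ j)))"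
  define E where "E = (\<lambda>j x. exp (s j * (2 * cosh (b $ j) * cos x - 2)))"
  have norm_eq: "norm (exp (of_real t * heat_symbol dx c b \<theta>) * wave b \<alpha> \<theta>)
      = (\<Prod>j\<in>UNIV. w j) * (\<Prod>j\<in>UNIV. E j (\<theta> j))" for \<theta>
  proof -
    have "Re (of_real t * heat_symbol dx c b \<theta>) = (\<Sum>j\<in>UNIV. s j * (2 * cosh (b $ j) * cos (\<theta> j) - 2))"
      by (simp add: Re_heat_symbol sum_distrib_left s_def mult_ac)
    then show ?thesis
      by (simp add: norm_mult norm_wave w_def E_def exp_sum)
  qed
  have "\<bar>heat_fundamental_solution dx c t \<alpha>\<bar>
      = norm (\<integral>\<theta>. exp (of_real t * heat_symbol dx c b \<theta>) * wave b \<alpha> \<theta> \<partial>torus_measure) / dx ^ CARD('d)"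
    using arg_cong[OF heat_fundamental_solution_eq_integral[of dx c t \<alpha> b], of norm] dx
    by (simp add: norm_divide norm_power)
  also have "\<dots> \<le> (\<integral>\<theta>. (\<Prod>j\<in>UNIV. w j) * (\<Prod>j\<in>UNIV. E j (\<theta> j)) \<partial>torus_measure) / dx ^ CARD('d)"
    using dx unfolding norm_eq[symmetric] by (intro divide_right_mono integral_norm_bound) auto
  also have "\<dots> = (\<Prod>j\<in>UNIV. w j / dx * (\<integral>x. E j x \<partial>circle_measure))"
  proof -
    have "integrable circle_measure (E j)" for j
    proof (rule circle.integrable_const_bound)
      show "AE x in circle_measure. norm (E j x) \<le> exp (s j * (2 * cosh (b $ j) * 1 - 2))"
        unfolding E_def using s by (intro AE_I2) (auto intro!: mult_left_mono less_imp_le)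
    qed (simp add: E_def)
    then show ?thesis
      by (simp add: integral_torus_prod prod.distrib prod_dividef)
  qed
  also have "\<dots> \<le> (\<Prod>j\<in>UNIV. w j / dx * (sqrt (pi / (4 * s j)) * exp (126 * s j * (b $ j)\<^sup>2)))"
    unfolding E_def
    using dx s b by (intro prod_mono conjI mult_left_mono integral_exp_cosh_cos_le mult_nonneg_nonneg)
      (auto simp: w_def)
  also have "\<dots> = (\<Prod>j\<in>UNIV. sqrt pi * (1 / sqrt (4 * c $ j * t) *
      exp (C0 * c $ j * t / (2 * dx\<^sup>2) * \<bar>b $ j\<bar>\<^sup>2 - real_of_int (\<alpha> $ j) * b $ j)))"
  proof (intro prod.cong refl)
    fix j
    have "sqrt (4 * s j) = sqrt (4 * c $ j * t) / dx"
      using dx by (simp add: s_def real_sqrt_divide mult_ac)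
    moreover have "exp (C0 * c $ j * t / (2 * dx\<^sup>2) * \<bar>b $ j\<bar>\<^sup>2 - real_of_int (\<alpha> $ j) * b $ j)
        = w j * exp (126 * s j * (b $ j)\<^sup>2)"
      by (simp add: w_def s_def C0_def algebra_simps flip: exp_add)
    ultimately show "w j / dx * (sqrt (pi / (4 * s j)) * exp (126 * s j * (b $ j)\<^sup>2)) =
      sqrt pi * (1 / sqrt (4 * c $ j * t) *
      exp (C0 * c $ j * t / (2 * dx\<^sup>2) * \<bar>b $ j\<bar>\<^sup>2 - real_of_int (\<alpha> $ j) * b $ j))"
      using dx by (simp add: real_sqrt_divide)
  qed
  also have "\<dots> = sqrt pi ^ CARD('d) * (\<Prod>j\<in>UNIV. 1 / sqrt (4 * c $ j * t) *
      exp (C0 * c $ j * t / (2 * dx\<^sup>2) * \<bar>b $ j\<bar>\<^sup>2 - real_of_int (\<alpha> $ j) * b $ j))"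
    by (simp only: prod.distrib prod_constant)
  also have "sqrt pi ^ CARD('d) = pi powr (real CARD('d) / 2)"
    by (simp add: powr_half_sqrt[symmetric] powr_realpow[symmetric] powr_powr)
  finally show ?thesis .
qed

text \<open>The exponent \<open>K b\<^sup>2 / (2 dx\<^sup>2) - \<alpha> b\<close> with \<open>K = C0 c t\<close> is minimal at \<open>b = \<alpha> dx\<^sup>2 / K\<close>; the lower bound on
  \<open>t\<close> says exactly that this shift satisfies \<open>\<bar>b\<bar> \<le> 2\<close>.\<close>

lemma heat_fundamental_solution_gaussian_bound:
  fixes dx t :: real and c :: "real ^ 'd::finite"
  assumes dx: "dx > 0" and c: "\<And>j. c $ j > 0" and t: "t > 0"
    and large: "\<And>j. \<bar>real_of_int (\<alpha> $ j)\<bar> * dx\<^sup>2 \<le> 2 * C0 * c $ j * t"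
  shows "\<bar>heat_fundamental_solution dx c t \<alpha>\<bar> \<le> pi powr (real CARD('d) / 2) *
    (\<Prod>j\<in>UNIV. 1 / sqrt (4 * c $ j * t) *
      exp (- ((real_of_int (\<alpha> $ j) * dx)\<^sup>2 / (2 * C0 * c $ j * t))))"
proof -
  define K where "K = (\<lambda>j. C0 * c $ j * t)"
  have K: "K j > 0" for j using c[of j] t by (simp add: K_def C0_def)
  define b :: "real ^ 'd" where "b = (\<chi> j. real_of_int (\<alpha> $ j) * dx\<^sup>2 / K j)"
  have "\<bar>b $ j\<bar> \<le> 2" for j
  proof -
    have "\<bar>b $ j\<bar> = \<bar>real_of_int (\<alpha> $ j)\<bar> * dx\<^sup>2 / K j"
      using K[of j] by (simp add: b_def abs_mult)
    also have "\<dots> \<le> 2"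
      using large[of j] K[of j] by (subst pos_divide_le_eq) (simp_all only: K_def mult.assoc)
    finally show ?thesis .
  qed
  note heat_fundamental_solution_bound[OF dx c t this, of \<alpha>]
  moreover have "C0 * c $ j * t / (2 * dx\<^sup>2) * \<bar>b $ j\<bar>\<^sup>2 - real_of_int (\<alpha> $ j) * b $ j
      = - ((real_of_int (\<alpha> $ j) * dx)\<^sup>2 / (2 * C0 * c $ j * t))" for j
  proof -
    have "K j / (2 * dx\<^sup>2) * (real_of_int (\<alpha> $ j) * dx\<^sup>2 / K j)\<^sup>2
          - real_of_int (\<alpha> $ j) * (real_of_int (\<alpha> $ j) * dx\<^sup>2 / K j)
        = - ((real_of_int (\<alpha> $ j) * dx)\<^sup>2 / (2 * K j))"
      using dx K[of j] by (simp add: field_simps power2_eq_square)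
    then show ?thesis by (simp only: b_def K_def mult.assoc power2_abs vec_lambda_beta)
  qed
  ultimately show ?thesis by simp
qed

theorem proposition3p6:
  fixes \<Delta>x :: real and c :: "real ^ 'd::finite"
  assumes "\<Delta>x > 0" and "\<And>j. c $ j > 0"
  shows "(\<forall>(\<alpha> :: int ^ 'd) (t :: real) (b :: real ^ 'd).
            t > 0 \<and> (\<forall>j. b $ j \<in> {-1/2..1/2}) \<longrightarrow>
            \<bar>heat_fundamental_solution \<Delta>x c t \<alpha>\<bar>
              \<le> pi powr (real CARD('d) / 2) *
                 (\<Prod>j\<in>UNIV. 1 / sqrt (4 * c $ j * t) *
                    exp (C0 * c $ j * t / (2 * \<Delta>x\<^sup>2) * \<bar>b $ j\<bar>\<^sup>2 - real_of_int (\<alpha> $ j) * b $ j)))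
       \<and> (\<forall>(\<alpha> :: int ^ 'd) (t :: real).
            t > 0 \<and>
            t \<ge> Max (range (\<lambda>j. real_of_int \<bar>\<alpha> $ j\<bar>)) * \<Delta>x\<^sup>2 / Min (range (\<lambda>j. 2 * C0 * c $ j)) \<longrightarrow>
            \<bar>heat_fundamental_solution \<Delta>x c t \<alpha>\<bar>
              \<le> pi powr (real CARD('d) / 2) *
                 (\<Prod>j\<in>UNIV. 1 / sqrt (4 * c $ j * t) *
                    exp (- ((real_of_int (\<alpha> $ j) * \<Delta>x)\<^sup>2 / (2 * C0 * c $ j * t)))))"
proof (intro conjI allI impI, goal_cases)
  case (1 \<alpha> t b)
  have "\<bar>b $ j\<bar> \<le> 2" for j
  proof -
    have "b $ j \<in> {-1/2..1/2}" using 1 by blast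
    then show ?thesis by auto
  qed
  with 1 show ?case by (intro heat_fundamental_solution_bound assms) auto
next
  case (2 \<alpha> t)
  define M where "M = Max (range (\<lambda>j. real_of_int \<bar>\<alpha> $ j\<bar>))"
  define m where "m = Min (range (\<lambda>j. 2 * C0 * c $ j))"
  have t: "t > 0" "M * \<Delta>x\<^sup>2 / m \<le> t" using 2 by (auto simp: M_def m_def)
  have "m \<in> range (\<lambda>j. 2 * C0 * c $ j)" unfolding m_def by (intro Min_in) auto
  then have "m > 0" using assms(2) by (auto simp: C0_def)
  have "\<bar>real_of_int (\<alpha> $ j)\<bar> * \<Delta>x\<^sup>2 \<le> 2 * C0 * c $ j * t" for j
  proof -
    have "real_of_int \<bar>\<alpha> $ j\<bar> \<le> M" unfolding M_def by (intro Max_ge) auto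
    then have "\<bar>real_of_int (\<alpha> $ j)\<bar> * \<Delta>x\<^sup>2 \<le> M * \<Delta>x\<^sup>2" by (intro mult_right_mono) auto
    also have "\<dots> \<le> m * t" using t \<open>m > 0\<close> by (simp add: field_simps)
    also have "m \<le> 2 * C0 * c $ j" unfolding m_def by (intro Min_le) auto
    then have "m * t \<le> 2 * C0 * c $ j * t" using t by (intro mult_right_mono) auto
    finally show ?thesis .
  qed
  then show ?case using t by (intro heat_fundamental_solution_gaussian_bound assms) auto
qed

end
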